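(* Let $p$ be a minimal idempotent in $(\beta\mathbb{N}, +)$, let $\langle B_n \rangle_{n=1}^\infty$ be a sequence of members of $p$, let $\langle A_n \rangle_{n=1}^\infty$ be a sequence of kernel partition regular matrices with entries from $\mathbb{Q}$, and let $m_n$ be the number of columns of $A_n$. Then for each $n \in \mathbb{N}$ there exists $\vec{x}_n \in \mathbb{N}^{m_n}$ with $A_n \vec{x}_n = \vec{0}$ such that for every nonempty finite $F \subseteq \mathbb{N}$, $\sum_{n \in F} Y_n \subseteq B_{\min F}$, where $Y_n$ denotes the set of entries of $\vec{x}_n$.
   Context: $\beta\mathbb{N}$ is the set of ultrafilters on $\mathbb{N}$ with the extension of addition $p+q = \{A \subseteq \mathbb{N} : \{x : -x+A \in q\} \in p\}$, $-x+A=\{y: x+y\in A\}$, a compact right topological semigroup. A minimal idempotent is an idempotent in the smallest two-sided ideal $K(\beta\mathbb{N})$. A finite $u\times v$ matrix $A$ with rational entries is kernel partition regular (over $\mathbb{N}$) if for every finite coloring of $\mathbb{N}$ there exists $\vec{x}\in\mathbb{N}^v$ whose entries all have the same color and $A\vec{x}=\vec{0}$. For finite $F \subseteq \mathbb{N}$ and nonempty sets $Y_n$, $\sum_{n \in F} Y_n = \{\sum_{n \in F} a_n : a_n \in Y_n \text{ for each } n \in F\}$. *)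

theory Defs
  imports Main "HOL.Rat"
begin

definition Npos :: "nat set" where
  "Npos = {n. 1 \<le> n}"

definition is_ultrafilter :: "nat set set \<Rightarrow> bool" where
  "is_ultrafilter U \<longleftrightarrow>
     U \<subseteq> Pow Npos \<and> Npos \<in> U \<and> {} \<notin> U \<and>
     (\<forall>A B. A \<in> U \<and> B \<in> U \<longrightarrow> A \<inter> B \<in> U) \<and>
     (\<forall>A B. A \<in> U \<and> A \<subseteq> B \<and> B \<subseteq> Npos \<longrightarrow> B \<in> U) \<and>
     (\<forall>A. A \<subseteq> Npos \<longrightarrow> A \<in> U \<or> Npos - A \<in> U)"

definition betaN :: "nat set set set" where
  "betaN = {U. is_ultrafilter U}"

definition shift :: "nat \<Rightarrow> nat set \<Rightarrow> nat set" where
  "shift x A = {y \<in> Npos. x + y \<in> A}"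

definition bplus :: "nat set set \<Rightarrow> nat set set \<Rightarrow> nat set set" where
  "bplus p q = {A. A \<subseteq> Npos \<and> {x \<in> Npos. shift x A \<in> q} \<in> p}"

definition two_sided_ideal :: "nat set set set \<Rightarrow> bool" where
  "two_sided_ideal I \<longleftrightarrow> I \<subseteq> betaN \<and> I \<noteq> {} \<and>
     (\<forall>p\<in>betaN. \<forall>q\<in>I. bplus p q \<in> I \<and> bplus q p \<in> I)"

definition K_beta :: "nat set set set" where
  "K_beta = \<Inter>{I. two_sided_ideal I}"

definition minimal_idempotent :: "nat set set \<Rightarrow> bool" where
  "minimal_idempotent p \<longleftrightarrow> p \<in> betaN \<and> bplus p p = p \<and> p \<in> K_beta"

text \<open>A u x v rational matrix is represented as a function of (row, column), indices 0-based.\<close>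
definition kernel_PR :: "nat \<Rightarrow> nat \<Rightarrow> (nat \<Rightarrow> nat \<Rightarrow> rat) \<Rightarrow> bool" where
  "kernel_PR u v A \<longleftrightarrow>
     (\<forall>c :: nat \<Rightarrow> nat. finite (c ` Npos) \<longrightarrow>
        (\<exists>x :: nat \<Rightarrow> nat. (\<forall>j<v. x j \<in> Npos) \<and>
            (\<forall>j<v. \<forall>k<v. c (x j) = c (x k)) \<and>
            (\<forall>i<u. (\<Sum>j<v. A i j * of_nat (x j)) = 0)))"

definition setsum_family :: "nat set \<Rightarrow> (nat \<Rightarrow> nat set) \<Rightarrow> nat set" where
  "setsum_family F Y = {(\<Sum>n\<in>F. a n) | a. \<forall>n\<in>F. a n \<in> Y n}"

end

theory Submission
  imports Defs "HOL-Library.FuncSet" "HOL-Computational_Algebra.Primes"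
begin

text \<open>For fixed finitely many sequences, the ultrafilters all of whose members are J-sets for these
  sequences form a two-sided ideal once there is one of them; the ideal then contains the smallest
  ideal and hence \<open>p\<close>. Existence is obtained by adding one sequence at a time: that \<open>p\<close> is idempotent
  and its members are J-sets for the old sequences yields a monochromatic configuration for the
  enlarged family in every finite partition.

  By Rado's colouring argument a kernel partition regular matrix satisfies the columns condition.
  The J-set property then lets one build a solution in a given member of \<open>p\<close> by adding the groups
  of columns of the partition one after the other. Finally, idempotence of \<open>p\<close> allows one to choose the
  solutions one after the other so that all mixed finite sums stay in the prescribed sets.\<close>

section \<open>Ultrafilters\<close>

lemma ultrafilter_subset: "is_ultrafilter U \<Longrightarrow> A \<in> U \<Longrightarrow> A \<subseteq> Npos"
  by (auto simp: is_ultrafilter_def)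

lemma ultrafilter_Int: "is_ultrafilter U \<Longrightarrow> A \<in> U \<Longrightarrow> B \<in> U \<Longrightarrow> A \<inter> B \<in> U"
  by (simp add: is_ultrafilter_def)

lemma ultrafilter_mono:
  "is_ultrafilter U \<Longrightarrow> A \<in> U \<Longrightarrow> A \<subseteq> B \<Longrightarrow> B \<subseteq> Npos \<Longrightarrow> B \<in> U"
  unfolding is_ultrafilter_def by blast

lemma ultrafilter_Npos: "is_ultrafilter U \<Longrightarrow> Npos \<in> U"
  by (simp add: is_ultrafilter_def)

lemma ultrafilter_nonempty: "is_ultrafilter U \<Longrightarrow> A \<in> U \<Longrightarrow> \<exists>x. x \<in> A"
  by (metis all_not_in_conv is_ultrafilter_def)

lemma ultrafilter_Compl_iff:
  assumes "is_ultrafilter U" "A \<subseteq> Npos"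
  shows "Npos - A \<in> U \<longleftrightarrow> A \<notin> U"
proof -
  have "\<not> (A \<in> U \<and> Npos - A \<in> U)"
    using ultrafilter_Int[OF assms(1), of A "Npos - A"] assms(1)
    by (auto simp: is_ultrafilter_def)
  then show ?thesis using assms unfolding is_ultrafilter_def by blast
qed

lemma ultrafilter_Ball:
  assumes U: "is_ultrafilter U" and "finite X" "\<And>x. x \<in> X \<Longrightarrow> D x \<in> U"
  shows "{z \<in> Npos. \<forall>x\<in>X. z \<in> D x} \<in> U"
  using assms(2,3)
proof (induction X rule: finite_induct)
  case empty
  then show ?case using ultrafilter_Npos[OF U] by simp
next
  case (insert x X)
  have "{z \<in> Npos. \<forall>x\<in>insert x X. z \<in> D x} = D x \<inter> {z \<in> Npos. \<forall>x\<in>X. z \<in> D x}"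
    using ultrafilter_subset[OF U insert.prems[of x]] by auto
  then show ?case using insert ultrafilter_Int[OF U] by simp
qed

lemma ultrafilter_Union:
  assumes U: "is_ultrafilter U" and "finite T" "\<And>A. A \<in> T \<Longrightarrow> A \<subseteq> Npos" "\<Union>T \<in> U"
  shows "\<exists>A\<in>T. A \<in> U"
proof (rule ccontr)
  assume "\<not> ?thesis"
  then have "{z \<in> Npos. \<forall>A\<in>T. z \<in> Npos - A} \<in> U"
    using ultrafilter_Ball[OF U assms(2), of "\<lambda>A. Npos - A"] ultrafilter_Compl_iff[OF U] assms(3) by auto
  then have "\<Union>T \<inter> {z \<in> Npos. \<forall>A\<in>T. z \<in> Npos - A} \<in> U"
    using ultrafilter_Int[OF U] assms(4) by blast
  moreover have "\<Union>T \<inter> {z \<in> Npos. \<forall>A\<in>T. z \<in> Npos - A} = {}" by auto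
  ultimately show False using ultrafilter_nonempty[OF U] by (metis empty_iff)
qed

text \<open>Zorn's lemma for the families that contain \<open>G\<close> and have no finite subfamily
  covering \<open>Npos\<close>: the sets outside a maximal one form the ultrafilter. In this way a
  property that some cell of every finite cover has passes to all members of a single
  ultrafilter.\<close>

lemma ultrafilter_avoiding:
  assumes "G \<subseteq> Pow Npos" "\<And>T. finite T \<Longrightarrow> T \<subseteq> G \<Longrightarrow> \<not> Npos \<subseteq> \<Union>T"
  shows "\<exists>U\<in>betaN. U \<inter> G = {}"
proof -
  define X where "X = {M. G \<subseteq> M \<and> M \<subseteq> Pow Npos \<and> (\<forall>T. finite T \<and> T \<subseteq> M \<longrightarrow> \<not> Npos \<subseteq> \<Union>T)}"
  have "G \<in> X" using assms by (auto simp: X_def)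
  then have "X \<noteq> {}" by auto
  moreover have "\<Union>C \<in> X" if C: "C \<noteq> {}" "subset.chain X C" for C
  proof -
    have "\<not> Npos \<subseteq> \<Union>T" if T: "finite T" "T \<subseteq> \<Union>C" for T
    proof -
      obtain M where "M \<in> C" "T \<subseteq> M"
        using finite_subset_Union_chain[OF T C(1)] C(2) by blast
      then show ?thesis using C(2) T(1) unfolding X_def subset.chain_def by blast
    qed
    moreover have "C \<subseteq> X" using C(2) by (simp add: subset.chain_def)
    moreover obtain M0 where "M0 \<in> C" using C(1) by blast
    moreover have "G \<subseteq> M \<and> M \<subseteq> Pow Npos" if "M \<in> C" for M
      using that \<open>C \<subseteq> X\<close> by (auto simp: X_def)
    then have "G \<subseteq> \<Union>C" "\<Union>C \<subseteq> Pow Npos" using \<open>M0 \<in> C\<close> by blast+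
    ultimately show ?thesis by (simp add: X_def)
  qed
  ultimately obtain M where M: "M \<in> X" and max: "\<And>Z. Z \<in> X \<Longrightarrow> M \<subseteq> Z \<Longrightarrow> Z = M"
    using subset_Zorn_nonempty[of X] by blast
  define U where "U = {A. A \<subseteq> Npos \<and> A \<notin> M}"
  \<comment> \<open>By maximality, adding \<open>A\<close> to \<open>M\<close> creates a finite
    cover, and dropping \<open>A\<close> from it leaves a cover of the complement. Closure under
    intersections and supersets is read off this criterion.\<close>
  have U: "A \<in> U \<longleftrightarrow> (\<exists>T. finite T \<and> T \<subseteq> M \<and> Npos - A \<subseteq> \<Union>T)" if A: "A \<subseteq> Npos" for A
  proof
    assume "A \<in> U"
    then have "insert A M \<notin> X" using max[of "insert A M"] by (auto simp: U_def)
    moreover have "G \<subseteq> insert A M" "insert A M \<subseteq> Pow Npos" using M A by (auto simp: X_def)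
    ultimately have "\<not> (\<forall>T. finite T \<and> T \<subseteq> insert A M \<longrightarrow> \<not> Npos \<subseteq> \<Union>T)" by (simp add: X_def)
    then obtain T where T: "finite T" "T \<subseteq> insert A M" "Npos \<subseteq> \<Union>T" by blast
    then have "finite (T - {A})" "T - {A} \<subseteq> M" "Npos - A \<subseteq> \<Union>(T - {A})" by auto
    then show "\<exists>T. finite T \<and> T \<subseteq> M \<and> Npos - A \<subseteq> \<Union>T" by blast
  next
    assume "\<exists>T. finite T \<and> T \<subseteq> M \<and> Npos - A \<subseteq> \<Union>T"
    then obtain T where T: "finite T" "T \<subseteq> M" "Npos - A \<subseteq> \<Union>T" by blast
    have "A \<notin> M"
    proof
      assume "A \<in> M"
      then have "finite (insert A T)" "insert A T \<subseteq> M" "Npos \<subseteq> \<Union>(insert A T)" using T by auto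
      then show False using M unfolding X_def by blast
    qed
    then show "A \<in> U" using A by (simp add: U_def)
  qed
  have "is_ultrafilter U"
    unfolding is_ultrafilter_def
  proof (intro conjI allI impI)
    show "U \<subseteq> Pow Npos" by (auto simp: U_def)
    show "Npos \<in> U" using U[of Npos] by auto
    show "{} \<notin> U" using U[of "{}"] M by (auto simp: X_def)
  next
    fix A B assume AB: "A \<in> U \<and> B \<in> U"
    then have sub: "A \<subseteq> Npos" "B \<subseteq> Npos" by (auto simp: U_def)
    obtain S T where "finite S" "S \<subseteq> M" "Npos - A \<subseteq> \<Union>S" "finite T" "T \<subseteq> M" "Npos - B \<subseteq> \<Union>T"
      using AB U[OF sub(1)] U[OF sub(2)] by blast
    then have "finite (S \<union> T)" "S \<union> T \<subseteq> M" "Npos - (A \<inter> B) \<subseteq> \<Union>(S \<union> T)" by auto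
    then show "A \<inter> B \<in> U" using U[of "A \<inter> B"] sub by blast
  next
    fix A B assume AB: "A \<in> U \<and> A \<subseteq> B \<and> B \<subseteq> Npos"
    then have "A \<subseteq> Npos" by blast
    then obtain T where "finite T" "T \<subseteq> M" "Npos - A \<subseteq> \<Union>T" using AB U[of A] by blast
    moreover have "Npos - B \<subseteq> Npos - A" using AB by blast
    ultimately show "B \<in> U" using U[of B] AB by (meson order_trans)
  next
    fix A assume A: "A \<subseteq> Npos"
    show "A \<in> U \<or> Npos - A \<in> U"
    proof (rule ccontr)
      assume "\<not> ?thesis"
      then have "finite {A, Npos - A}" "{A, Npos - A} \<subseteq> M" "Npos \<subseteq> \<Union>{A, Npos - A}"
        using A by (auto simp: U_def)
      then show False using M unfolding X_def by blast
    qed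
  qed
  moreover have "U \<inter> G = {}" using M by (auto simp: U_def X_def)
  ultimately show ?thesis by (auto simp: betaN_def)
qed

section \<open>Sums of ultrafilters\<close>

lemma shift_subset: "shift x A \<subseteq> Npos"
  by (auto simp: shift_def)

lemma shift_shift: "shift y (shift x A) = shift (x + y) A"
  by (auto simp: shift_def Npos_def add.assoc)

text \<open>Shifting commutes with intersection and complement, and membership in \<open>q\<close>
  respects both, so the passage from \<open>A\<close> to
  \<open>{x \<in> Npos. shift x A \<in> q}\<close> pulls the ultrafilter \<open>p\<close> back to an
  ultrafilter.\<close>

lemma bplus_in_betaN:
  assumes "p \<in> betaN" "q \<in> betaN"
  shows "bplus p q \<in> betaN"
proof -
  have p: "is_ultrafilter p" and q: "is_ultrafilter q" using assms by (auto simp: betaN_def)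
  have Int: "{x \<in> Npos. shift x (A \<inter> B) \<in> q} = {x \<in> Npos. shift x A \<in> q} \<inter> {x \<in> Npos. shift x B \<in> q}" for A B
  proof -
    have "shift x (A \<inter> B) = shift x A \<inter> shift x B" for x by (auto simp: shift_def)
    moreover have "shift x A \<inter> shift x B \<in> q \<longleftrightarrow> shift x A \<in> q \<and> shift x B \<in> q" for x
      using ultrafilter_Int[OF q] ultrafilter_mono[OF q _ _ shift_subset] by (meson inf_le1 inf_le2)
    ultimately show ?thesis by auto
  qed
  have Compl: "{x \<in> Npos. shift x (Npos - A) \<in> q} = Npos - {x \<in> Npos. shift x A \<in> q}" for A
  proof -
    have "shift x (Npos - A) = Npos - shift x A" for x by (auto simp: shift_def Npos_def)
    then show ?thesis using ultrafilter_Compl_iff[OF q shift_subset] by auto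
  qed
  have "is_ultrafilter (bplus p q)"
    unfolding is_ultrafilter_def
  proof (intro conjI allI impI)
    show "bplus p q \<subseteq> Pow Npos" by (auto simp: bplus_def)
    have "shift x Npos = Npos" for x by (auto simp: shift_def Npos_def)
    then show "Npos \<in> bplus p q"
      using ultrafilter_Npos[OF p] ultrafilter_Npos[OF q] by (simp add: bplus_def)
    have "shift x {} = {}" for x by (simp add: shift_def)
    moreover have "{} \<notin> p" "{} \<notin> q" using p q by (auto simp: is_ultrafilter_def)
    ultimately show "{} \<notin> bplus p q" by (simp add: bplus_def)
  next
    fix A B assume "A \<in> bplus p q \<and> B \<in> bplus p q"
    then show "A \<inter> B \<in> bplus p q"
      using ultrafilter_Int[OF p] Int[of A B] by (auto simp: bplus_def)
  next
    fix A B assume AB: "A \<in> bplus p q \<and> A \<subseteq> B \<and> B \<subseteq> Npos"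
    then have "A \<inter> B = A" by blast
    then have "{x \<in> Npos. shift x A \<in> q} \<subseteq> {x \<in> Npos. shift x B \<in> q}" using Int[of A B] by auto
    then show "B \<in> bplus p q" using AB ultrafilter_mono[OF p] by (auto simp: bplus_def)
  next
    fix A assume "A \<subseteq> Npos"
    then show "A \<in> bplus p q \<or> Npos - A \<in> bplus p q"
      using ultrafilter_Compl_iff[OF p, of "{x \<in> Npos. shift x A \<in> q}"] Compl[of A]
      by (auto simp: bplus_def)
  qed
  then show ?thesis by (simp add: betaN_def)
qed

section \<open>Idempotent ultrafilters\<close>

lemma idempotent_shift:
  assumes "bplus p p = p" "shift x A \<in> p"
  shows "{z \<in> Npos. shift (x + z) A \<in> p} \<in> p"
proof -
  have "shift x A \<in> bplus p p" using assms by simp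
  then show ?thesis by (simp add: bplus_def shift_shift)
qed

text \<open>These are the points of \<open>A\<close> from which \<open>p\<close>-almost every step
  stays in \<open>A\<close>; the choices in \<open>idempotent_sequence\<close> are made inside such
  sets.\<close>

lemma idempotent_star:
  assumes "p \<in> betaN" "bplus p p = p" "A \<in> p"
  shows "{x \<in> A. shift x A \<in> p} \<in> p"
proof -
  have p: "is_ultrafilter p" using assms(1) by (simp add: betaN_def)
  have "A \<in> bplus p p" using assms by simp
  then have "{x \<in> Npos. shift x A \<in> p} \<in> p" by (simp add: bplus_def)
  then have "A \<inter> {x \<in> Npos. shift x A \<in> p} \<in> p" using ultrafilter_Int[OF p] assms(3) by blast
  moreover have "A \<inter> {x \<in> Npos. shift x A \<in> p} = {x \<in> A. shift x A \<in> p}"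
    using ultrafilter_subset[OF p assms(3)] by auto
  ultimately show ?thesis by simp
qed

text \<open>One residue class modulo \<open>c\<close> belongs to \<open>p\<close>, and idempotence
  forces its residue to satisfy \<open>r + r = r\<close>. The divisibility is used later to clear
  denominators.\<close>

lemma idempotent_multiples:
  assumes p: "p \<in> betaN" and idem: "bplus p p = p" and c: "c > 0"
  shows "{n \<in> Npos. c dvd n} \<in> p"
proof -
  have u: "is_ultrafilter p" using p by (simp add: betaN_def)
  define R where "R r = {n \<in> Npos. n mod c = r}" for r
  have "\<Union>(R ` {..<c}) = Npos" using c by (auto simp: R_def)
  then have "\<exists>A\<in>R ` {..<c}. A \<in> p"
    using ultrafilter_Union[OF u, of "R ` {..<c}"] ultrafilter_Npos[OF u] by (auto simp: R_def)
  then obtain r where r: "R r \<in> p" by blast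
  from ultrafilter_nonempty[OF u idempotent_star[OF p idem r]]
  obtain x where x: "x \<in> R r" "shift x (R r) \<in> p" by blast
  from ultrafilter_nonempty[OF u ultrafilter_Int[OF u x(2) r]]
  obtain y where y: "y \<in> shift x (R r)" "y \<in> R r" by blast
  have "x mod c = y mod c" "(x + y) mod c = y mod c" using x y by (auto simp: R_def shift_def)
  then have "c dvd x" by (metis add_diff_cancel_right' add_diff_cancel_left' diff_zero dvd_minus_mod le_add2 mod_eq_dvd_iff_nat)
  then have "r = 0" using x by (auto simp: R_def)
  then show ?thesis using r by (simp add: R_def dvd_eq_mod_eq_0)
qed

text \<open>Each new set \<open>E n (f n)\<close> is placed inside a member of \<open>p\<close>
  whose points extend all earlier sums. The values and \<open>Q\<close> stay abstract because the
  lemma serves twice: for integer solutions of one system and for the whole sequence of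
  systems.\<close>

lemma idempotent_sequence:
  fixes Q :: "nat \<Rightarrow> 'v \<Rightarrow> bool" and E :: "nat \<Rightarrow> 'v \<Rightarrow> nat set"
  assumes p: "p \<in> betaN" and idem: "bplus p p = p"
    and B: "\<And>n. B n \<in> p"
    and fin: "\<And>n v. finite (E n v)"
    and ex: "\<And>n D. D \<in> p \<Longrightarrow> \<exists>v. Q n v \<and> E n v \<subseteq> D"
  shows "\<exists>f. (\<forall>n. Q n (f n)) \<and>
    (\<forall>F a. finite F \<and> F \<noteq> {} \<and> (\<forall>n\<in>F. a n \<in> E n (f n)) \<longrightarrow> sum a F \<in> B (Min F))"
proof -
  have u: "is_ultrafilter p" using p by (simp add: betaN_def)
  define St where "St n = {x \<in> B n. shift x (B n) \<in> p}" for n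
  have St: "St n \<in> p" for n unfolding St_def by (rule idempotent_star[OF p idem B])
  \<comment> \<open>Steps from a point of \<open>St n\<close> lead \<open>p\<close>-almost surely
    back into \<open>St n\<close>, not merely into \<open>B n\<close>, so the construction never
    gets stuck.\<close>
  have St_shift: "shift x (St n) \<in> p" if "x \<in> St n" for x n
  proof -
    have 1: "shift x (B n) \<in> p" using that by (simp add: St_def)
    have "shift x (B n) \<inter> {z \<in> Npos. shift (x + z) (B n) \<in> p} \<in> p"
      by (rule ultrafilter_Int[OF u 1 idempotent_shift[OF idem 1]])
    moreover have "shift x (B n) \<inter> {z \<in> Npos. shift (x + z) (B n) \<in> p} = shift x (St n)"
      by (auto simp: shift_def St_def)
    ultimately show ?thesis by simp
  qed
  \<comment> \<open>The index set is kept along with the sum because the target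
    \<open>B (Min F)\<close> depends on it.\<close>
  define S where "S f n = {(F, sum a F) | F a. F \<subseteq> {..<n} \<and> F \<noteq> {} \<and> (\<forall>i\<in>F. a i \<in> E i (f i))}"
    for f n
  have finS: "finite (S f n)" for f n
  proof -
    \<comment> \<open>Only the values of \<open>a\<close> on \<open>F\<close> matter, and after
      restriction to \<open>F\<close> finitely many functions remain.\<close>
    have "S f n \<subseteq> (\<lambda>(F, a). (F, sum a F)) ` (SIGMA F:Pow {..<n}. PiE F (\<lambda>i. E i (f i)))"
    proof
      fix s assume "s \<in> S f n"
      then obtain F a where s: "s = (F, sum a F)" "F \<subseteq> {..<n}" "\<forall>i\<in>F. a i \<in> E i (f i)"
        unfolding S_def by blast
      then have "(F, restrict a F) \<in> (SIGMA F:Pow {..<n}. PiE F (\<lambda>i. E i (f i)))"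
        by (auto simp: PiE_def Pi_def)
      moreover have "s = (\<lambda>(F, a). (F, sum a F)) (F, restrict a F)" using s by simp
      ultimately show "s \<in> (\<lambda>(F, a). (F, sum a F)) ` (SIGMA F:Pow {..<n}. PiE F (\<lambda>i. E i (f i)))"
        by blast
    qed
    moreover have "finite (SIGMA F:Pow {..<n}. PiE F (\<lambda>i. E i (f i)))"
      by (intro finite_SigmaI finite_PiE fin) (auto intro: finite_subset)
    ultimately show ?thesis using finite_surj by blast
  qed
  define D where "D f n = St n \<inter> {z \<in> Npos. \<forall>(F, s)\<in>S f n. z \<in> shift s (St (Min F))}" for f n
  define P where "P f n v \<longleftrightarrow> Q n v \<and> E n v \<subseteq> D f n" for f n v
  have S_St: "s \<in> St (Min F)" if "\<And>i. i < n \<Longrightarrow> P f i (f i)" "(F, s) \<in> S f n" for f n F s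
    using that
  proof (induction n arbitrary: F s)
    case 0
    then show ?case by (auto simp: S_def)
  next
    case (Suc n)
    obtain a where a: "s = sum a F" "F \<subseteq> {..<Suc n}" "F \<noteq> {}" "\<forall>i\<in>F. a i \<in> E i (f i)"
      using Suc.prems(2) by (auto simp: S_def)
    have IH: "t \<in> St (Min H)" if "(H, t) \<in> S f n" for H t
      using Suc.IH[OF _ that] Suc.prems(1) by simp
    have finF: "finite F" using a finite_subset by blast
    show ?case
    proof (cases "n \<in> F")
      case False
      then have "F \<subseteq> {..<n}" using a by (auto simp: less_Suc_eq)
      then have "(F, s) \<in> S f n" using a by (auto simp: S_def)
      then show ?thesis by (rule IH)
    next
      case True
      then have an: "a n \<in> D f n" using a Suc.prems(1)[of n] by (auto simp: P_def)
      \<comment> \<open>The largest index \<open>n\<close> is peeled off, so the minimum, and with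
        it the target set, is the same for \<open>H\<close> and \<open>F\<close> unless
        \<open>H\<close> is empty.\<close>
      define H where "H = F - {n}"
      have s: "s = a n + sum a H" using a True finF by (simp add: H_def sum.remove)
      show ?thesis
      proof (cases "H = {}")
        case True
        then have "F = {n}" using \<open>n \<in> F\<close> by (auto simp: H_def)
        then show ?thesis using an a by (simp add: D_def)
      next
        case False
        have H: "H \<subseteq> {..<n}" using a by (auto simp: H_def less_Suc_eq)
        have "(H, sum a H) \<in> S f n" using False H a by (auto simp: S_def H_def)
        then have "a n \<in> shift (sum a H) (St (Min H))" using an by (auto simp: D_def)
        moreover have "Min F = Min H"
        proof -
          have "F = insert n H" using True by (auto simp: H_def)
          moreover have "finite H" using finF by (simp add: H_def)
          moreover have "Min H \<le> n" using H False \<open>finite H\<close> Min_in[of H] by fastforce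
          ultimately show ?thesis using False by (simp add: Min_insert min_absorb2)
        qed
        ultimately show ?thesis using s by (simp add: shift_def add.commute)
      qed
    qed
  qed
  \<comment> \<open>Course-of-values choice: \<open>S f n\<close> looks at \<open>f\<close> only
    below \<open>n\<close>, hence so does the requirement on the \<open>n\<close>-th value.\<close>
  have "\<exists>f. \<forall>n. P f n (f n)"
  proof (rule dependent_wf_choice[of less_than])
    show "wf less_than" by simp
  next
    fix f g :: "nat \<Rightarrow> 'v" and n v
    assume eq: "\<And>z. (z, n) \<in> less_than \<Longrightarrow> f z = g z"
    have "S f n = S g n" unfolding S_def using eq
      by (intro Collect_cong ex_cong1) (metis less_than_iff lessThan_iff subsetD)
    then show "P f n v = P g n v" by (simp add: P_def D_def)
  next
    fix n and f :: "nat \<Rightarrow> 'v"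
    assume "\<And>y. (y, n) \<in> less_than \<Longrightarrow> P f y (f y)"
    then have "shift (snd Fs) (St (Min (fst Fs))) \<in> p" if "Fs \<in> S f n" for Fs
      using S_St[of n f "fst Fs" "snd Fs"] that St_shift by simp
    then have "{z \<in> Npos. \<forall>Fs\<in>S f n. z \<in> shift (snd Fs) (St (Min (fst Fs)))} \<in> p"
      by (rule ultrafilter_Ball[OF u finS])
    then have "D f n \<in> p" using ultrafilter_Int[OF u St] by (simp add: D_def case_prod_unfold)
    then show "\<exists>v. P f n v" using ex unfolding P_def by blast
  qed
  then obtain f where f: "\<And>n. P f n (f n)" by blast
  have "sum a F \<in> B (Min F)" if "finite F" "F \<noteq> {}" "\<forall>n\<in>F. a n \<in> E n (f n)" for F a
  proof -
    have "F \<subseteq> {..<Suc (Max F)}" using that by (auto simp: less_Suc_eq_le)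
    then have "(F, sum a F) \<in> S f (Suc (Max F))" using that unfolding S_def by blast
    then show ?thesis using S_St[OF f] by (auto simp: St_def)
  qed
  moreover have "\<forall>n. Q n (f n)" using f by (simp add: P_def)
  ultimately show ?thesis by blast
qed

section \<open>Members of minimal idempotents are J-sets\<close>

text \<open>The J-set condition for one fixed family of sequences. The bound \<open>N\<close> is
  there so that successive index sets can be chosen disjoint.\<close>

definition J_set_for :: "('l \<Rightarrow> nat \<Rightarrow> nat) \<Rightarrow> 'l set \<Rightarrow> nat set \<Rightarrow> bool" where
  "J_set_for y L A \<longleftrightarrow>
     (\<forall>N. \<exists>a H. finite H \<and> H \<noteq> {} \<and> H \<subseteq> {N..} \<and> (\<forall>l\<in>L. a + sum (y l) H \<in> A))"

text \<open>On either side the other summand is absorbed into \<open>a\<close>, while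
  \<open>H\<close> is unchanged. For \<open>bplus q p\<close> a single \<open>b\<close> must serve
  all letters at once, which is where finiteness of \<open>L\<close> enters; \<open>U\<close>
  provides nonemptiness.\<close>

lemma J_set_for_ideal:
  assumes "finite L" "U \<in> betaN" "\<And>A. A \<in> U \<Longrightarrow> J_set_for y L A"
  shows "two_sided_ideal {q \<in> betaN. \<forall>A\<in>q. J_set_for y L A}"
  unfolding two_sided_ideal_def
proof (intro conjI ballI)
  show "{q \<in> betaN. \<forall>A\<in>q. J_set_for y L A} \<noteq> {}" using assms by blast
next
  fix p q assume p: "p \<in> betaN" and "q \<in> {q \<in> betaN. \<forall>A\<in>q. J_set_for y L A}"
  then have q: "q \<in> betaN" "\<And>A. A \<in> q \<Longrightarrow> J_set_for y L A" by auto
  have up: "is_ultrafilter p" using p by (simp add: betaN_def)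
  have "J_set_for y L A" if "A \<in> bplus p q" for A
    unfolding J_set_for_def
  proof
    fix N
    have "{x \<in> Npos. shift x A \<in> q} \<in> p" using that by (simp add: bplus_def)
    then obtain x where "shift x A \<in> q" using ultrafilter_nonempty[OF up] by blast
    then have "J_set_for y L (shift x A)" by (rule q)
    then obtain a H where H: "finite H" "H \<noteq> {}" "H \<subseteq> {N..}" "\<forall>l\<in>L. a + sum (y l) H \<in> shift x A"
      unfolding J_set_for_def by meson
    then have "\<forall>l\<in>L. (x + a) + sum (y l) H \<in> A" by (auto simp: shift_def add.assoc)
    then show "\<exists>a H. finite H \<and> H \<noteq> {} \<and> H \<subseteq> {N..} \<and> (\<forall>l\<in>L. a + sum (y l) H \<in> A)"
      using H by blast
  qed
  then show "bplus p q \<in> {q \<in> betaN. \<forall>A\<in>q. J_set_for y L A}"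
    using bplus_in_betaN[OF p q(1)] by simp
  have "J_set_for y L A" if "A \<in> bplus q p" for A
    unfolding J_set_for_def
  proof
    fix N
    have "{x \<in> Npos. shift x A \<in> p} \<in> q" using that by (simp add: bplus_def)
    then have "J_set_for y L {x \<in> Npos. shift x A \<in> p}" by (rule q)
    then obtain a H where H: "finite H" "H \<noteq> {}" "H \<subseteq> {N..}"
      "\<forall>l\<in>L. a + sum (y l) H \<in> {x \<in> Npos. shift x A \<in> p}"
      unfolding J_set_for_def by meson
    then have "{z \<in> Npos. \<forall>l\<in>L. z \<in> shift (a + sum (y l) H) A} \<in> p"
      using ultrafilter_Ball[OF up assms(1)] by simp
    then obtain b where "\<forall>l\<in>L. b \<in> shift (a + sum (y l) H) A"
      using ultrafilter_nonempty[OF up] by blast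
    then have "\<forall>l\<in>L. (a + b) + sum (y l) H \<in> A" by (auto simp: shift_def algebra_simps)
    then show "\<exists>a H. finite H \<and> H \<noteq> {} \<and> H \<subseteq> {N..} \<and> (\<forall>l\<in>L. a + sum (y l) H \<in> A)"
      using H by blast
  qed
  then show "bplus q p \<in> {q \<in> betaN. \<forall>A\<in>q. J_set_for y L A}"
    using bplus_in_betaN[OF q(1) p] by simp
qed auto

text \<open>Colour focusing with \<open>p\<close> in the role of the finite bounds: the prefixes \<open>w i\<close> use only the
  new letter \<open>k\<close>, each gets a cell \<open>c (w i)\<close> that holds \<open>p\<close>-almost surely after it, and the blocks
  are chosen so that appending blocks with an old letter keeps this cell. Two prefixes with the
  same cell then give the set of blocks on which the letter varies.\<close>
lemma focusing:
  assumes p: "p \<in> betaN" and idem: "bplus p p = p" and L: "finite L" "k \<notin> L"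
    and J: "\<And>A. A \<in> p \<Longrightarrow> J_set_for y L A"
    and T: "finite T" "T \<subseteq> Pow Npos" "Npos \<subseteq> \<Union>T"
  shows "\<exists>A\<in>T. \<exists>a H. finite H \<and> H \<noteq> {} \<and> H \<subseteq> {N..} \<and> (\<forall>l\<in>insert k L. a + sum (y l) H \<in> A)"
proof -
  have u: "is_ultrafilter p" using p by (simp add: betaN_def)
  have "\<exists>A\<in>T. shift x A \<in> p" for x
  proof -
    have "Npos \<subseteq> \<Union>(shift x ` T)"
    proof
      fix z assume "z \<in> Npos"
      then have "x + z \<in> Npos" by (simp add: Npos_def)
      then have "x + z \<in> \<Union>T" using T(3) by blast
      then show "z \<in> \<Union>(shift x ` T)" using \<open>z \<in> Npos\<close> by (auto simp: shift_def)
    qed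
    then have "\<Union>(shift x ` T) = Npos" using shift_subset by blast
    then show ?thesis
      using ultrafilter_Union[OF u, of "shift x ` T"] ultrafilter_Npos[OF u] T shift_subset by auto
  qed
  then obtain c where c: "\<And>x. c x \<in> T" "\<And>x. shift x (c x) \<in> p" by metis
  \<comment> \<open>A block \<open>f s\<close> consists of a constant and an index set, and
    \<open>v f l s\<close> is its value for the letter \<open>l\<close>. The word behind
    \<open>X f i t l\<close> has length \<open>t\<close>, with \<open>k\<close> in the first
    \<open>i\<close> positions and \<open>l\<close> in the others.\<close>
  define v where "v f l s = fst (f s) + sum (y l) (snd (f s))"
    for f :: "nat \<Rightarrow> nat \<times> nat set" and l s
  define w where "w f i = (\<Sum>s<i. v f k s)" for f i
  define X where "X f i t l = w f i + (\<Sum>s\<in>{i..<t}. v f l s)" for f i t l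
  \<comment> \<open>The next block lies beyond \<open>N\<close> and all earlier blocks, and it keeps
    the cell of each prefix \<open>w f i\<close>, whichever old letter fills the positions from
    \<open>i\<close> on.\<close>
  define P where "P f t bH \<longleftrightarrow> finite (snd bH) \<and> snd bH \<noteq> {} \<and> snd bH \<subseteq> {N..} \<and>
      (\<forall>s<t. \<forall>h\<in>snd (f s). \<forall>h'\<in>snd bH. h < h') \<and>
      (\<forall>l\<in>L. \<forall>i\<le>t. shift (X f i t l + (fst bH + sum (y l) (snd bH))) (c (w f i)) \<in> p)"
    for f t and bH :: "nat \<times> nat set"
  have inv: "shift (X f i t l) (c (w f i)) \<in> p"
    if P: "\<And>s. s < t \<Longrightarrow> P f s (f s)" and it: "i \<le> t" and l: "l \<in> L" for f i t l
  proof (cases "i = t")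
    case True
    then show ?thesis using c by (simp add: X_def)
  next
    case False
    then obtain t' where t': "t = Suc t'" "i \<le> t'" using it by (cases t) auto
    then have "X f i t l = X f i t' l + v f l t'" by (simp add: X_def)
    then show ?thesis using P[of t'] l t' by (simp add: P_def v_def)
  qed
  have "\<exists>f. \<forall>t. P f t (f t)"
  proof (rule dependent_wf_choice[of less_than])
    show "wf less_than" by simp
  next
    fix f g :: "nat \<Rightarrow> nat \<times> nat set" and t bH
    assume "\<And>z. (z, t) \<in> less_than \<Longrightarrow> f z = g z"
    then have eq: "\<And>s. s < t \<Longrightarrow> f s = g s" by simp
    have w: "w f i = w g i" if "i \<le> t" for i
      unfolding w_def v_def using that eq by (intro sum.cong) auto
    have "X f i t l = X g i t l" if "i \<le> t" for i l
      unfolding X_def w[OF that] unfolding v_def using eq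
      by (intro arg_cong2[of _ _ _ _ "(+)"] sum.cong) auto
    then show "P f t bH = P g t bH" using eq w by (auto simp: P_def)
  next
    fix t and f :: "nat \<Rightarrow> nat \<times> nat set"
    assume IH: "\<And>s. (s, t) \<in> less_than \<Longrightarrow> P f s (f s)"
    \<comment> \<open>There are finitely many pairs of a prefix and an old letter, so by idempotence
      the admissible increments form a member \<open>D\<close> of \<open>p\<close>; its J-set
      property supplies the block.\<close>
    define I where "I = {..t} \<times> L"
    define D where "D = {z \<in> Npos. \<forall>x\<in>I. z \<in> {z \<in> Npos. shift (X f (fst x) t (snd x) + z) (c (w f (fst x))) \<in> p}}"
    have "D \<in> p" unfolding D_def
    proof (rule ultrafilter_Ball[OF u])
      show "finite I" using L(1) by (simp add: I_def)
      fix x assume "x \<in> I"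
      then show "{z \<in> Npos. shift (X f (fst x) t (snd x) + z) (c (w f (fst x))) \<in> p} \<in> p"
        using idempotent_shift[OF idem inv[of t f]] IH by (auto simp: I_def)
    qed
    then have D: "J_set_for y L D" by (rule J)
    have "finite (\<Union>s<t. snd (f s))" using IH by (auto simp: P_def)
    then obtain N' where N': "\<And>h. h \<in> (\<Union>s<t. snd (f s)) \<Longrightarrow> h < N'"
      using finite_nat_set_iff_bounded[of "\<Union>s<t. snd (f s)"] by metis
    obtain a H where H: "finite H" "H \<noteq> {}" "H \<subseteq> {max N N'..}" "\<forall>l\<in>L. a + sum (y l) H \<in> D"
      using D unfolding J_set_for_def by meson
    have "P f t (a, H)" using H N' by (fastforce simp: P_def D_def I_def)
    then show "\<exists>bH. P f t bH" by blast
  qed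
  then obtain f where f: "\<And>t. P f t (f t)" by blast
  have "\<not> inj (\<lambda>i. c (w f i))"
    using T(1) c(1) finite_subset[of "range (\<lambda>i. c (w f i))" T] finite_imageD[of "\<lambda>i. c (w f i)" UNIV]
    by auto
  then obtain i j where ij: "i < j" "c (w f i) = c (w f j)"
    unfolding inj_def by (metis linorder_neqE_nat)
  define A where "A = c (w f i)"
  \<comment> \<open>The letter \<open>k\<close> is covered by \<open>w f j\<close>, which has the
    same cell as \<open>w f i\<close>, and the old letters by \<open>inv\<close>; one continuation
    \<open>z\<close> puts all these values into \<open>A\<close>.\<close>
  have "{z \<in> Npos. \<forall>x\<in>insert (w f j) (X f i j ` L). z \<in> shift x A} \<in> p"
    by (rule ultrafilter_Ball[OF u])
      (use L(1) c(2)[of "w f j"] ij inv[OF f, of i j] in \<open>auto simp: A_def\<close>)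
  then obtain z where z: "\<forall>x\<in>insert (w f j) (X f i j ` L). z \<in> shift x A"
    using ultrafilter_nonempty[OF u] by blast
  \<comment> \<open>The letter varies over the blocks \<open>i\<close> to \<open>j - 1\<close>;
    everything independent of it is collected in \<open>a\<close>.\<close>
  define H where "H = (\<Union>s\<in>{i..<j}. snd (f s))"
  define a where "a = w f i + (\<Sum>s\<in>{i..<j}. fst (f s)) + z"
  have fP: "finite (snd (f t))" "snd (f t) \<noteq> {}" "snd (f t) \<subseteq> {N..}" for t
    using f[of t] by (auto simp: P_def)
  have "snd (f s) \<inter> snd (f t) = {}" if "s < t" for s t
    using f[of t] that by (fastforce simp: P_def)
  then have disj: "snd (f s) \<inter> snd (f t) = {}" if "s \<noteq> t" for s t
    using that by (metis Int_commute linorder_neqE_nat)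
  have sumH: "a + sum (y l) H = X f i j l + z" for l
  proof -
    have "sum (y l) H = (\<Sum>s\<in>{i..<j}. sum (y l) (snd (f s)))"
      unfolding H_def by (rule sum.UNION_disjoint) (use fP disj in auto)
    then show ?thesis by (simp add: a_def X_def v_def sum.distrib)
  qed
  have "w f j = X f i j k"
    using ij(1) sum.atLeastLessThan_concat[of 0 i j "v f k"]
    by (simp add: w_def X_def atLeast0LessThan)
  then have "\<forall>l\<in>insert k L. a + sum (y l) H \<in> A"
    using z by (auto simp: sumH shift_def)
  moreover have "finite H" "H \<subseteq> {N..}" using fP by (auto simp: H_def)
  moreover have "H \<noteq> {}" using fP(2)[of i] ij(1) by (auto simp: H_def)
  ultimately show ?thesis using c(1)[of "w f i"] unfolding A_def by blast
qed

text \<open>Induction on the letters. By \<open>focusing\<close> the sets that fail for the enlarged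
  family admit no finite cover, so some ultrafilter avoids them; the resulting ideal contains
  \<open>K_beta\<close>.\<close>

lemma minimal_idempotent_J_set:
  assumes p: "minimal_idempotent p" and "finite L" "A \<in> p"
  shows "J_set_for y L A"
  using assms(2,3)
proof (induction L arbitrary: A rule: finite_induct)
  case empty
  have "finite {N} \<and> {N} \<noteq> {} \<and> {N} \<subseteq> {N..}" for N :: nat by simp
  then show ?case unfolding J_set_for_def by blast
next
  case (insert k L)
  have pb: "p \<in> betaN" and idem: "bplus p p = p" and K: "p \<in> K_beta"
    using p by (auto simp: minimal_idempotent_def)
  define G where "G = {A. A \<subseteq> Npos \<and> \<not> J_set_for y (insert k L) A}"
  have "\<not> Npos \<subseteq> \<Union>T" if T: "finite T" "T \<subseteq> G" for T
  proof
    assume cov: "Npos \<subseteq> \<Union>T"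
    have "\<forall>A\<in>T. \<exists>N. \<forall>a H. finite H \<longrightarrow> H \<noteq> {} \<longrightarrow> H \<subseteq> {N..} \<longrightarrow> \<not> (\<forall>l\<in>insert k L. a + sum (y l) H \<in> A)"
    proof
      fix A assume "A \<in> T"
      then have "\<not> J_set_for y (insert k L) A" using T(2) by (auto simp: G_def)
      then show "\<exists>N. \<forall>a H. finite H \<longrightarrow> H \<noteq> {} \<longrightarrow> H \<subseteq> {N..} \<longrightarrow> \<not> (\<forall>l\<in>insert k L. a + sum (y l) H \<in> A)"
        unfolding J_set_for_def by meson
    qed
    then obtain N where N: "\<And>A a H. A \<in> T \<Longrightarrow> finite H \<Longrightarrow> H \<noteq> {} \<Longrightarrow> H \<subseteq> {N A..} \<Longrightarrow>
        \<not> (\<forall>l\<in>insert k L. a + sum (y l) H \<in> A)"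
      by metis
    have "T \<subseteq> Pow Npos" using T(2) by (auto simp: G_def)
    \<comment> \<open>Each cell of \<open>T\<close> fails at its own bound \<open>N A\<close>; the
      maximum of these finitely many bounds contradicts all of them together.\<close>
    from focusing[OF pb idem insert.hyps insert.IH T(1) this cov, of "Max (N ` T)"]
    obtain A a H where *: "A \<in> T" "finite H" "H \<noteq> {}" "H \<subseteq> {Max (N ` T)..}"
      "\<forall>l\<in>insert k L. a + sum (y l) H \<in> A" by blast
    have "N A \<le> Max (N ` T)" using T(1) *(1) by simp
    then have "H \<subseteq> {N A..}" using *(4) by auto
    then show False using N * by blast
  qed
  then obtain U where U: "U \<in> betaN" "U \<inter> G = {}"
    using ultrafilter_avoiding[of G] by (auto simp: G_def)
  have "J_set_for y (insert k L) A" if "A \<in> U" for A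
    using U that ultrafilter_subset[of U A] by (auto simp: G_def betaN_def)
  then have "two_sided_ideal {q \<in> betaN. \<forall>A\<in>q. J_set_for y (insert k L) A}"
    using J_set_for_ideal[of "insert k L" U y] U(1) insert.hyps by simp
  then have "p \<in> {q \<in> betaN. \<forall>A\<in>q. J_set_for y (insert k L) A}"
    using K unfolding K_beta_def by blast
  then show ?case using insert.prems by blast
qed

section \<open>Rado's columns condition\<close>

text \<open>If column \<open>k\<close> depends on the earlier ones, a functional killing those kills
  it too. Otherwise some \<open>w\<close> kills the earlier columns but not \<open>k\<close>, and is
  used to eliminate column \<open>k\<close>. The functional of the second alternative is the
  obstruction in Rado's argument.\<close>

lemma fredholm_alternative:
  fixes a :: "nat \<Rightarrow> 'j \<Rightarrow> 'k::field"
  assumes "finite L"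
  shows "(\<exists>y. \<forall>i<u. b i = (\<Sum>j\<in>L. a i j * y j)) \<or>
    (\<exists>w. (\<forall>j\<in>L. (\<Sum>i<u. w i * a i j) = 0) \<and> (\<Sum>i<u. w i * b i) \<noteq> 0)"
  using assms
proof (induction L arbitrary: b rule: finite_induct)
  case empty
  show ?case
  proof (cases "\<forall>i<u. b i = 0")
    case False
    then obtain i0 where "i0 < u" "b i0 \<noteq> 0" by blast
    then have "(\<Sum>i<u. (if i = i0 then 1 else 0) * b i) \<noteq> 0"
      by (simp add: if_distrib[of "\<lambda>x. x * _"] cong: if_cong)
    then show ?thesis by (metis empty_iff)
  qed simp
next
  case (insert k L)
  consider y where "\<forall>i<u. a i k = (\<Sum>j\<in>L. a i j * y j)"
    | w where "\<forall>j\<in>L. (\<Sum>i<u. w i * a i j) = 0" "(\<Sum>i<u. w i * a i k) \<noteq> 0"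
    using insert.IH[of "\<lambda>i. a i k"] by blast
  then show ?case
  proof cases
    case 1
    from insert.IH[of b] show ?thesis
    proof
      assume "\<exists>x. \<forall>i<u. b i = (\<Sum>j\<in>L. a i j * x j)"
      then obtain x where x: "\<forall>i<u. b i = (\<Sum>j\<in>L. a i j * x j)" by blast
      have "\<forall>i<u. b i = (\<Sum>j\<in>insert k L. a i j * (x(k := 0)) j)"
        using insert.hyps x by (auto intro!: sum.cong)
      then show ?thesis by blast
    next
      assume "\<exists>w. (\<forall>j\<in>L. (\<Sum>i<u. w i * a i j) = 0) \<and> (\<Sum>i<u. w i * b i) \<noteq> 0"
      then obtain w where w: "\<forall>j\<in>L. (\<Sum>i<u. w i * a i j) = 0" "(\<Sum>i<u. w i * b i) \<noteq> 0" by blast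
      have "(\<Sum>i<u. w i * a i k) = (\<Sum>i<u. \<Sum>j\<in>L. y j * (w i * a i j))"
        using 1 by (intro sum.cong) (auto simp: sum_distrib_left algebra_simps)
      also have "\<dots> = (\<Sum>j\<in>L. y j * (\<Sum>i<u. w i * a i j))"
        by (subst sum.swap) (simp add: sum_distrib_left)
      also have "\<dots> = 0" using w by simp
      finally show ?thesis using w by blast
    qed
  next
    case 2
    define s where "s = (\<Sum>i<u. w i * a i k)"
    \<comment> \<open>The coefficient of column \<open>k\<close> for which \<open>w\<close>
      annihilates the remainder of \<open>b\<close>.\<close>
    define r where "r = (\<Sum>i<u. w i * b i) / s"
    have s: "s \<noteq> 0" using 2 by (simp add: s_def)
    from insert.IH[of "\<lambda>i. b i - r * a i k"] show ?thesis
    proof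
      assume "\<exists>x. \<forall>i<u. b i - r * a i k = (\<Sum>j\<in>L. a i j * x j)"
      then obtain x where x: "\<forall>i<u. b i - r * a i k = (\<Sum>j\<in>L. a i j * x j)" by blast
      have "b i = (\<Sum>j\<in>insert k L. a i j * (x(k := r)) j)" if "i < u" for i
      proof -
        have "(\<Sum>j\<in>L. a i j * (x(k := r)) j) = (\<Sum>j\<in>L. a i j * x j)"
          using insert.hyps by (intro sum.cong) auto
        moreover have "b i = r * a i k + (\<Sum>j\<in>L. a i j * x j)"
          using x that by (simp add: algebra_simps)
        ultimately show ?thesis using insert.hyps by (simp add: mult.commute)
      qed
      then show ?thesis by blast
    next
      assume "\<exists>w'. (\<forall>j\<in>L. (\<Sum>i<u. w' i * a i j) = 0) \<and> (\<Sum>i<u. w' i * (b i - r * a i k)) \<noteq> 0"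
      then obtain w' where w': "\<forall>j\<in>L. (\<Sum>i<u. w' i * a i j) = 0"
        "(\<Sum>i<u. w' i * (b i - r * a i k)) \<noteq> 0" by blast
      \<comment> \<open>Subtracting \<open>t\<close> times \<open>w\<close> makes the functional
        vanish on column \<open>k\<close> as well, and its value on \<open>b\<close> becomes that of
        \<open>w'\<close> on the remainder.\<close>
      define t where "t = (\<Sum>i<u. w' i * a i k) / s"
      define v where "v i = w' i - t * w i" for i
      have v: "(\<Sum>i<u. v i * g i) = (\<Sum>i<u. w' i * g i) - t * (\<Sum>i<u. w i * g i)" for g
        by (simp add: v_def algebra_simps sum_subtractf sum_distrib_left)
      have "(\<Sum>i<u. v i * a i j) = 0" if "j \<in> insert k L" for j
        using that w' 2 s by (auto simp: v t_def s_def[symmetric])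
      moreover have "(\<Sum>i<u. v i * b i) = (\<Sum>i<u. w' i * (b i - r * a i k))"
      proof -
        have "(\<Sum>i<u. w' i * (b i - r * a i k)) = (\<Sum>i<u. w' i * b i) - r * (\<Sum>i<u. w' i * a i k)"
          by (simp add: algebra_simps sum_subtractf sum_distrib_left)
        then show ?thesis using s by (simp add: v t_def r_def)
      qed
      ultimately show ?thesis using w'(2) by metis
    qed
  qed
qed

lemma common_denominator:
  fixes z :: "'j \<Rightarrow> rat"
  assumes "finite L"
  shows "\<exists>d::nat. d > 0 \<and> (\<exists>g. \<forall>j\<in>L. of_nat d * z j = of_int (g j))"
  using assms
proof (induction L rule: finite_induct)
  case empty
  show ?case by (rule exI[of _ 1]) simp
next
  case (insert k L)
  then obtain d g where d: "d > 0" "\<And>j. j \<in> L \<Longrightarrow> of_nat d * z j = of_int (g j)" by blast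
  obtain a b where ab: "quotient_of (z k) = (a, b)" by force
  have b: "b > 0" "z k = of_int a / of_int b"
    using quotient_of_denom_pos[OF ab] quotient_of_div[OF ab] by auto
  define g' where "g' j = (if j = k then int d * a else g j * b)" for j
  have "of_nat (d * nat b) * z j = of_int (g' j)" if "j \<in> insert k L" for j
  proof -
    have nb: "(of_nat (nat b) :: rat) = of_int b" using b(1) by simp
    show ?thesis
    proof (cases "j = k")
      case True
      then show ?thesis using b nb by (simp add: g'_def)
    next
      case False
      then have "of_nat d * z j = of_int (g j)" using d that by blast
      then show ?thesis using False nb by (simp add: g'_def algebra_simps)
    qed
  qed
  moreover have "d * nat b > 0" using d b by simp
  ultimately show ?case by blast
qed

text \<open>The columns condition, with the ordered partition of the columns given by a rank function.
  The rank of a column is the \<open>q\<close>-adic order of the corresponding entry of a solution that is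
  monochromatic for the last nonzero base-\<open>q\<close> digit, \<open>q\<close> being a large prime.\<close>
lemma kernel_PR_columns_condition:
  assumes "kernel_PR u v A"
  shows "\<exists>h::nat \<Rightarrow> nat. \<forall>e. \<exists>z::nat \<Rightarrow> rat. (\<forall>j<v. h j = e \<longrightarrow> z j = 1) \<and> (\<forall>j<v. e < h j \<longrightarrow> z j = 0) \<and>
    (\<forall>i<u. (\<Sum>j<v. A i j * z j) = 0)"
proof -
  \<comment> \<open>An integral obstruction: a combination \<beta> of the rows, zero on the columns
    \<open>Lo\<close>, with nonzero sum over \<open>I\<close>. Its existence is what has to be
    refuted.\<close>
  define W where "W I Lo \<beta> \<longleftrightarrow> (\<exists>w. \<forall>j<v. of_int (\<beta> j) = (\<Sum>i<u. w i * A i j)) \<and> (\<forall>j\<in>Lo. \<beta> j = 0) \<and>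
     (\<Sum>j\<in>I. \<beta> j) \<noteq> 0" for I Lo :: "nat set" and \<beta> :: "nat \<Rightarrow> int"
  \<comment> \<open>One obstruction is picked for each of the finitely many pairs that have one, and
    \<open>q\<close> exceeds all their sums. For the other pairs the arbitrary value only enlarges
    \<open>M\<close>.\<close>
  define bd where "bd = (\<lambda>(I, Lo). nat \<bar>\<Sum>j\<in>I. (SOME \<beta>. W I Lo \<beta>) j\<bar>)"
  define M where "M = Max (bd ` (Pow {..<v} \<times> Pow {..<v}))"
  obtain q where q: "prime q" "q > M" using bigger_prime by blast
  have q_bound: "\<exists>\<beta>. W I Lo \<beta> \<and> \<bar>\<Sum>j\<in>I. \<beta> j\<bar> < int q"
    if "W I Lo \<beta>0" "I \<subseteq> {..<v}" "Lo \<subseteq> {..<v}" for I Lo \<beta>0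
  proof -
    have "bd (I, Lo) \<le> M" unfolding M_def using that by (intro Max_ge) auto
    then have "\<bar>\<Sum>j\<in>I. (SOME \<beta>. W I Lo \<beta>) j\<bar> < int q" using q(2) by (simp add: bd_def)
    moreover have "W I Lo (SOME \<beta>. W I Lo \<beta>)" using that(1) by (rule someI[of "W I Lo"])
    ultimately show ?thesis by blast
  qed
  define c where "c n = (n div q ^ multiplicity q n) mod q" for n
  have "c ` Npos \<subseteq> {..<q}" using prime_gt_0_nat[OF q(1)] by (auto simp: c_def)
  then have "finite (c ` Npos)" using finite_subset by blast
  then have "\<exists>x :: nat \<Rightarrow> nat. (\<forall>j<v. x j \<in> Npos) \<and> (\<forall>j<v. \<forall>k<v. c (x j) = c (x k)) \<and>
      (\<forall>i<u. (\<Sum>j<v. A i j * of_nat (x j)) = 0)"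
    using assms by (simp add: kernel_PR_def)
  then obtain x :: "nat \<Rightarrow> nat" where "\<forall>j<v. x j \<in> Npos" "\<forall>j<v. \<forall>k<v. c (x j) = c (x k)"
    "\<forall>i<u. (\<Sum>j<v. A i j * of_nat (x j)) = 0" by (elim exE conjE)
  then have x: "\<And>j. j < v \<Longrightarrow> x j \<in> Npos" "\<And>j k. j < v \<Longrightarrow> k < v \<Longrightarrow> c (x j) = c (x k)"
    "\<And>i. i < u \<Longrightarrow> (\<Sum>j<v. A i j * of_nat (x j)) = 0" by blast+
  define h where "h j = multiplicity q (x j)" for j
  have q_nu: "\<not> is_unit q" using q(1) by auto
  have "\<exists>z::nat \<Rightarrow> rat. (\<forall>j<v. h j = e \<longrightarrow> z j = 1) \<and> (\<forall>j<v. e < h j \<longrightarrow> z j = 0) \<and>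
    (\<forall>i<u. (\<Sum>j<v. A i j * z j) = 0)" for e
  proof -
    define I where "I = {j. j < v \<and> h j = e}"
    define Lo where "Lo = {j. j < v \<and> h j < e}"
    have fin: "finite I" "finite Lo" by (auto simp: I_def Lo_def)
    have noW: "\<not> W I Lo \<beta>0" for \<beta>0
    proof
      assume "W I Lo \<beta>0"
      then obtain \<beta> where \<beta>: "W I Lo \<beta>" "\<bar>\<Sum>j\<in>I. \<beta> j\<bar> < int q"
        using q_bound[of I Lo \<beta>0] by (auto simp: I_def Lo_def)
      then obtain w where w: "\<And>j. j < v \<Longrightarrow> of_int (\<beta> j) = (\<Sum>i<u. w i * A i j)" unfolding W_def by blast
      have \<beta>0: "\<And>j. j \<in> Lo \<Longrightarrow> \<beta> j = 0" and ne: "(\<Sum>j\<in>I. \<beta> j) \<noteq> 0" using \<beta>(1) by (auto simp: W_def)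
      have "(of_int (\<Sum>j<v. \<beta> j * int (x j)) :: rat) = (\<Sum>j<v. (\<Sum>i<u. w i * A i j) * of_nat (x j))"
        by (simp add: w)
      also have "\<dots> = (\<Sum>j<v. \<Sum>i<u. w i * (A i j * of_nat (x j)))"
        by (simp add: sum_distrib_right mult.assoc)
      also have "\<dots> = (\<Sum>i<u. w i * (\<Sum>j<v. A i j * of_nat (x j)))"
        by (subst sum.swap) (simp add: sum_distrib_left)
      also have "\<dots> = 0" using x(3) by simp
      finally have zero: "(\<Sum>j<v. \<beta> j * int (x j)) = 0" by (metis of_int_eq_0_iff)
      have "I \<noteq> {}" using ne by auto
      then obtain j0 where j0: "j0 < v" "h j0 = e" by (auto simp: I_def)
      define d where "d = c (x j0)"
      have cx: "c (x j) = d" if "j < v" for j unfolding d_def by (rule x(2)[OF that j0(1)])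
      define t where "t j = x j div q ^ h j" for j
      have xt: "x j = q ^ h j * t j" for j
        by (simp add: t_def h_def multiplicity_dvd)
      have td: "t j mod q = d" if "j < v" for j using cx[OF that] by (simp add: c_def t_def h_def)
      have "\<not> q dvd t j0"
      proof -
        have "x j0 \<noteq> 0" using x(1)[OF j0(1)] by (auto simp: Npos_def)
        then show ?thesis unfolding t_def h_def using q_nu multiplicity_decompose by blast
      qed
      then have d0: "\<not> int q dvd int d"
        using td[OF j0(1)] by (metis dvd_mod_iff dvd_refl of_nat_dvd_iff)
      \<comment> \<open>Modulo the power \<open>e + 1\<close> of \<open>q\<close> only the columns
        in \<open>I\<close> survive: \<beta> vanishes on \<open>Lo\<close>, entries of higher rank
        are divisible, and those of rank \<open>e\<close> have the common last digit
        \<open>d\<close>.\<close>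
      have "int q ^ Suc e dvd \<beta> j * int (x j) - (if j \<in> I then int q ^ e * int d * \<beta> j else 0)" if "j < v" for j
      proof -
        consider "j \<in> Lo" | "j \<in> I" | "h j > e"
          using \<open>j < v\<close> linorder_less_linear[of "h j" e] by (auto simp: I_def Lo_def)
        then show ?thesis
        proof cases
          case 1
          then have "j \<notin> I" by (auto simp: I_def Lo_def)
          then show ?thesis using \<beta>0[OF 1] by simp
        next
          case 2
          then have "h j = e" by (simp add: I_def)
          then have "int (x j) = int q ^ e * int (t j)" using xt[of j] by simp
          moreover have "int q dvd int (t j) - int d"
            using td[OF that] by (metis mod_eq_dvd_iff mod_mod_trivial of_nat_mod)
          then have "int q ^ e * int q dvd int q ^ e * (int (t j) - int d)" by (rule mult_dvd_mono[OF dvd_refl])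
          then have "int q ^ Suc e dvd \<beta> j * (int q ^ e * (int (t j) - int d))"
            by (simp add: mult.commute)
          ultimately show ?thesis using 2 by (simp add: algebra_simps)
        next
          case 3
          then have "int q ^ Suc e dvd int q ^ h j" by (intro le_imp_power_dvd) simp
          then have "int q ^ Suc e dvd int (x j)" using xt[of j] by (simp only: of_nat_mult of_nat_power dvd_mult2)
          moreover have "j \<notin> I" using 3 by (simp add: I_def)
          ultimately show ?thesis by simp
        qed
      qed
      then have "int q ^ Suc e dvd (\<Sum>j<v. \<beta> j * int (x j) - (if j \<in> I then int q ^ e * int d * \<beta> j else 0))"
        by (intro dvd_sum) auto
      also have "(\<Sum>j<v. \<beta> j * int (x j) - (if j \<in> I then int q ^ e * int d * \<beta> j else 0)) =
          - (\<Sum>j<v. (if j \<in> I then int q ^ e * int d * \<beta> j else 0))"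
        using zero by (simp add: sum_subtractf)
      also have "(\<Sum>j<v. (if j \<in> I then int q ^ e * int d * \<beta> j else 0)) = (\<Sum>j\<in>I. int q ^ e * int d * \<beta> j)"
        by (rule sum.mono_neutral_cong_right) (auto simp: I_def)
      finally have "int q ^ e * int q dvd int q ^ e * (int d * (\<Sum>j\<in>I. \<beta> j))"
        by (simp add: sum_distrib_left algebra_simps)
      then have "int q dvd int d * (\<Sum>j\<in>I. \<beta> j)" using prime_gt_0_nat[OF q(1)] by simp
      then have "int q dvd (\<Sum>j\<in>I. \<beta> j)" using d0 q(1) by (simp add: prime_dvd_mult_iff)
      then show False using \<beta>(2) ne by (meson dvd_imp_le_int linorder_not_less abs_of_nat order.strict_trans2 zdvd_not_zless dvd_abs_iff zero_less_abs_iff)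
    qed
    \<comment> \<open>The columns in \<open>Lo\<close> must span minus the sum of the columns in
      \<open>I\<close>; a separating functional would, after clearing denominators, be an
      obstruction.\<close>
    from fredholm_alternative[OF fin(2), of u "\<lambda>i. \<Sum>j\<in>I. - A i j" A]
    have "\<exists>y. \<forall>i<u. (\<Sum>j\<in>I. - A i j) = (\<Sum>j\<in>Lo. A i j * y j)"
    proof
      assume "\<exists>w. (\<forall>j\<in>Lo. (\<Sum>i<u. w i * A i j) = 0) \<and> (\<Sum>i<u. w i * (\<Sum>j\<in>I. - A i j)) \<noteq> 0"
      then obtain w where w: "\<And>j. j \<in> Lo \<Longrightarrow> (\<Sum>i<u. w i * A i j) = 0"
        "(\<Sum>i<u. w i * (\<Sum>j\<in>I. - A i j)) \<noteq> 0" by blast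
      obtain d g where d: "d > 0" "\<And>j. j < v \<Longrightarrow> of_nat d * (\<Sum>i<u. w i * A i j) = of_int (g j)"
        using common_denominator[of "{..<v}" "\<lambda>j. \<Sum>i<u. w i * A i j"] by auto
      have "W I Lo g" unfolding W_def
      proof (intro conjI ballI)
        show "\<exists>w. \<forall>j<v. of_int (g j) = (\<Sum>i<u. w i * A i j)"
          using d(2) by (intro exI[of _ "\<lambda>i. of_nat d * w i"]) (simp add: sum_distrib_left mult.assoc)
        show "g j = 0" if "j \<in> Lo" for j
          using d(2)[of j] w(1)[OF that] that by (simp add: Lo_def)
        have "(of_int (\<Sum>j\<in>I. g j) :: rat) = (\<Sum>j\<in>I. of_nat d * (\<Sum>i<u. w i * A i j))"
          using d(2) by (simp add: I_def)
        also have "\<dots> = of_nat d * (\<Sum>i<u. \<Sum>j\<in>I. w i * A i j)"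
          by (subst sum.swap) (simp add: sum_distrib_left)
        also have "\<dots> = - of_nat d * (\<Sum>i<u. w i * (\<Sum>j\<in>I. - A i j))"
          by (simp add: sum_distrib_left sum_negf)
        also have "\<dots> \<noteq> 0" using w(2) d(1) by simp
        finally show "(\<Sum>j\<in>I. g j) \<noteq> 0" by (metis of_int_0)
      qed
      then show ?thesis using noW by blast
    qed
    then obtain y where y: "\<And>i. i < u \<Longrightarrow> (\<Sum>j\<in>I. - A i j) = (\<Sum>j\<in>Lo. A i j * y j)" by blast
    define z where "z j = (if j \<in> I then 1 else if j \<in> Lo then y j else 0)" for j
    have "(\<Sum>j<v. A i j * z j) = 0" if "i < u" for i
    proof -
      have "(\<Sum>j<v. A i j * z j) = (\<Sum>j\<in>I \<union> Lo. A i j * z j)"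
        by (rule sum.mono_neutral_right) (auto simp: z_def I_def Lo_def)
      also have "\<dots> = (\<Sum>j\<in>I. A i j * z j) + (\<Sum>j\<in>Lo. A i j * z j)"
        by (rule sum.union_disjoint) (auto simp: fin, auto simp: I_def Lo_def)
      also have "(\<Sum>j\<in>I. A i j * z j) = (\<Sum>j\<in>I. A i j)" by (simp add: z_def)
      also have "(\<Sum>j\<in>Lo. A i j * z j) = (\<Sum>j\<in>Lo. A i j * y j)"
        by (rule sum.cong) (auto simp: z_def I_def Lo_def)
      finally show ?thesis using y[OF that] by (simp add: sum_negf)
    qed
    then show ?thesis by (intro exI[of _ z]) (auto simp: z_def I_def Lo_def)
  qed
  then show ?thesis by blast
qed

section \<open>Solutions in members of a minimal idempotent\<close>

text \<open>Adds a group \<open>I\<close> of columns to the set \<open>J\<close> of columns whose entries are already in the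
  given member of \<open>p\<close>: the new solution is a sum over \<open>H\<close> of old ones plus a multiple of \<open>z\<close>.\<close>
lemma kernel_solution_step:
  fixes A :: "nat \<Rightarrow> nat \<Rightarrow> rat" and z :: "nat \<Rightarrow> rat"
  assumes p: "minimal_idempotent p"
    and J: "\<And>C c. C \<in> p \<Longrightarrow> (c::nat) > 0 \<Longrightarrow> \<exists>x::nat \<Rightarrow> int. (\<forall>i<u. (\<Sum>j<v. A i j * of_int (x j)) = 0) \<and>
           (\<forall>j\<in>J. x j \<in> int ` C) \<and> (\<forall>j<v. int c dvd x j)"
    and z: "\<And>i. i < u \<Longrightarrow> (\<Sum>j<v. A i j * z j) = 0" "\<And>j. j \<in> I \<Longrightarrow> z j = 1" "\<And>j. j \<in> J \<Longrightarrow> z j = 0"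
    and IJ: "I \<subseteq> {..<v}" "J \<subseteq> {..<v}" "I \<noteq> {}"
    and C: "C \<in> p" and c: "(c::nat) > 0"
  shows "\<exists>x::nat \<Rightarrow> int. (\<forall>i<u. (\<Sum>j<v. A i j * of_int (x j)) = 0) \<and>
           (\<forall>j\<in>I \<union> J. x j \<in> int ` C) \<and> (\<forall>j<v. int c dvd x j)"
proof -
  have pb: "p \<in> betaN" and idem: "bplus p p = p" using p by (auto simp: minimal_idempotent_def)
  have up: "is_ultrafilter p" using pb by (simp add: betaN_def)
  have fin: "finite I" "finite J" using IJ finite_subset by blast+
  obtain d g where d: "d > 0" "\<And>j. j < v \<Longrightarrow> of_nat d * z j = of_int (g j)"
    using common_denominator[of "{..<v}" z] by auto
  have cd: "c * d > 0" using c d by simp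
  \<comment> \<open>Old solutions are required to be divisible by \<open>c * d\<close>, so that
    divisibility by \<open>c\<close> survives once the denominator \<open>d\<close> of
    \<open>z\<close> is cleared.\<close>
  define Q where "Q x \<longleftrightarrow> (\<forall>i<u. (\<Sum>j<v. A i j * of_int (x j)) = 0) \<and> (\<forall>j<v. int (c * d) dvd x j) \<and>
      (\<forall>j\<in>J. x j \<in> range int)" for x :: "nat \<Rightarrow> int"
  \<comment> \<open>A whole sequence of old solutions is chosen, so that their sum over any nonempty
    finite \<open>H\<close> still has its \<open>J\<close> entries in \<open>C\<close>.\<close>
  have "\<exists>X :: nat \<Rightarrow> nat \<Rightarrow> int. (\<forall>n. Q (X n)) \<and> (\<forall>F a. finite F \<and> F \<noteq> {} \<and> (\<forall>n\<in>F. a n \<in> (\<lambda>j. nat (X n j)) ` J) \<longrightarrow> sum a F \<in> C)"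
  proof (rule idempotent_sequence[OF pb idem, where B = "\<lambda>_. C" and Q = "\<lambda>_. Q"
        and E = "\<lambda>n x. (\<lambda>j. nat (x j)) ` J"])
    fix D assume "D \<in> p"
    from J[OF this cd] obtain x :: "nat \<Rightarrow> int" where
      x: "\<forall>i<u. (\<Sum>j<v. A i j * of_int (x j)) = 0" "\<forall>j\<in>J. x j \<in> int ` D" "\<forall>j<v. int (c * d) dvd x j"
      by blast
    have "Q x" unfolding Q_def using x by blast
    moreover have "(\<lambda>j. nat (x j)) ` J \<subseteq> D" using x(2) by force
    ultimately show "\<exists>x. Q x \<and> (\<lambda>j. nat (x j)) ` J \<subseteq> D" by blast
  qed (use C fin in auto)
  then obtain X :: "nat \<Rightarrow> nat \<Rightarrow> int" where "\<forall>n. Q (X n)" and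
    X2: "\<forall>F a. finite F \<and> F \<noteq> {} \<and> (\<forall>n\<in>F. a n \<in> (\<lambda>j. nat (X n j)) ` J) \<longrightarrow> sum a F \<in> C"
    by (elim exE conjE)
  then have X: "\<And>n. Q (X n)" by simp
  \<comment> \<open>J-sets are about sequences of naturals while the solutions may have negative
    entries; \<open>m n\<close> lifts them, and its sum over \<open>H\<close> is moved into
    \<open>b\<close>.\<close>
  define m where "m n = (\<Sum>j<v. \<bar>X n j\<bar>)" for n
  have m: "X n j + m n \<ge> 0" if "j < v" for n j
  proof -
    have "\<bar>X n j\<bar> \<le> m n" unfolding m_def using that by (intro member_le_sum) auto
    then show ?thesis by linarith
  qed
  define y where "y j n = nat (X n j + m n)" for j n
  \<comment> \<open>Divisibility of \<open>b + x0 j\<close> for one column \<open>j\<close> of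
    \<open>I\<close>, together with that of \<open>x0 j\<close>, makes \<open>b\<close> a multiple
    of \<open>c * d\<close>.\<close>
  define C' where "C' = C \<inter> {n \<in> Npos. (c * d) dvd n}"
  have "C' \<in> p" unfolding C'_def
    using ultrafilter_Int[OF up C idempotent_multiples[OF pb idem cd]] .
  then have "J_set_for y I C'" by (rule minimal_idempotent_J_set[OF p fin(1)])
  then obtain a H where H: "finite H" "H \<noteq> {}" "\<And>l. l \<in> I \<Longrightarrow> a + sum (y l) H \<in> C'"
    unfolding J_set_for_def by meson
  define b where "b = int a + (\<Sum>n\<in>H. m n)"
  define x0 where "x0 j = (\<Sum>n\<in>H. X n j)" for j
  have x0_dvd: "int (c * d) dvd x0 j" if "j < v" for j
    unfolding x0_def using X that by (intro dvd_sum) (auto simp: Q_def)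
  have x0_I: "b + x0 j \<in> int ` C'" if "j \<in> I" for j
  proof -
    have "int (a + sum (y j) H) = b + x0 j"
      using m that IJ by (auto simp: y_def b_def x0_def sum.distrib)
    then show ?thesis using H(3)[OF that] by (metis imageI)
  qed
  have x0_J: "x0 j \<in> int ` C" if "j \<in> J" for j
  proof -
    have "X n j = int (nat (X n j))" for n using X[of n] that by (auto simp: Q_def)
    then have "x0 j = int (\<Sum>n\<in>H. nat (X n j))" by (simp add: x0_def)
    moreover have "(\<Sum>n\<in>H. nat (X n j)) \<in> C"
      using X2[rule_format, of H "\<lambda>n. nat (X n j)"] H that by simp
    ultimately show ?thesis by blast
  qed
  obtain j1 where j1: "j1 \<in> I" using IJ by blast
  have "int (c * d) dvd b + x0 j1" using x0_I[OF j1] by (auto simp: C'_def simp flip: of_nat_mult)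
  then have "int (c * d) dvd b"
    using x0_dvd[of j1] j1 IJ by (metis dvd_add_left_iff lessThan_iff subsetD)
  then obtain b' where b': "b = int (c * d) * b'" by blast
  \<comment> \<open>This is \<open>x0 j + b * z j\<close> with the denominator cleared:
    \<open>z\<close> is 0 on \<open>J\<close>, where \<open>x0\<close> is kept, and 1 on
    \<open>I\<close>, where \<open>b\<close> is added.\<close>
  define x where "x j = x0 j + int c * b' * g j" for j
  have x_rat: "of_int (x j) = of_int (x0 j) + of_int b * z j" if "j < v" for j
    by (simp add: x_def b' d(2)[OF that, symmetric])
  have "x j \<in> int ` C" if "j \<in> I \<union> J" for j
  proof (cases "j \<in> J")
    case True
    then have "(of_int (x j) :: rat) = of_int (x0 j)" using x_rat[of j] z(3) IJ by auto
    then show ?thesis using x0_J[OF True] by simp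
  next
    case False
    then have "j \<in> I" using that by simp
    then have "(of_int (x j) :: rat) = of_int (x0 j + b)" using x_rat[of j] z(2) IJ by auto
    then have "x j = b + x0 j" by (simp only: of_int_eq_iff)
    then show ?thesis using x0_I[OF \<open>j \<in> I\<close>] by (auto simp: C'_def)
  qed
  moreover have "int c dvd x j" if "j < v" for j
    using x0_dvd[OF that] by (auto simp: x_def intro: dvd_mult_left)
  moreover have "(\<Sum>j<v. A i j * of_int (x j)) = 0" if "i < u" for i
  proof -
    have "(\<Sum>j<v. A i j * of_int (x j)) = (\<Sum>j<v. A i j * of_int (x0 j)) + of_int b * (\<Sum>j<v. A i j * z j)"
      by (simp add: x_rat distrib_left sum.distrib sum_distrib_left algebra_simps)
    also have "(\<Sum>j<v. A i j * of_int (x0 j)) = (\<Sum>n\<in>H. \<Sum>j<v. A i j * of_int (X n j))"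
      by (subst sum.swap) (simp add: x0_def sum_distrib_left)
    also have "\<dots> = 0" using X that by (simp add: Q_def)
    finally show ?thesis using z(1)[OF that] by simp
  qed
  ultimately show ?thesis by blast
qed

text \<open>Downward induction on the rank: the zero vector serves above all ranks, and each step
  brings in the columns of one rank. Intermediate vectors are integral with arbitrary divisibility;
  at rank 0 all entries lie in \<open>C\<close>.\<close>

lemma kernel_PR_minimal_idempotent:
  assumes p: "minimal_idempotent p" and A: "kernel_PR u v A" and C: "C \<in> p"
  shows "\<exists>x::nat \<Rightarrow> nat. (\<forall>j<v. x j \<in> C) \<and> (\<forall>i<u. (\<Sum>j<v. A i j * of_nat (x j)) = 0)"
proof -
  obtain h :: "nat \<Rightarrow> nat" where "\<forall>e. \<exists>z::nat \<Rightarrow> rat. (\<forall>j<v. h j = e \<longrightarrow> z j = 1) \<and> (\<forall>j<v. e < h j \<longrightarrow> z j = 0) \<and>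
    (\<forall>i<u. (\<Sum>j<v. A i j * z j) = 0)"
    using kernel_PR_columns_condition[OF A] by (elim exE)
  note h = this[rule_format]
  define M where "M = Suc (\<Sum>j<v. h j)"
  have M: "h j < M" if "j < v" for j
    unfolding M_def using that member_le_sum[of j "{..<v}" h] by (auto simp: less_Suc_eq_le)
  define P where "P e \<longleftrightarrow> (\<forall>C c. C \<in> p \<longrightarrow> (c::nat) > 0 \<longrightarrow> (\<exists>x::nat \<Rightarrow> int. (\<forall>i<u. (\<Sum>j<v. A i j * of_int (x j)) = 0) \<and>
           (\<forall>j\<in>{j. j < v \<and> e \<le> h j}. x j \<in> int ` C) \<and> (\<forall>j<v. int c dvd x j)))" for e
  have "P 0"
  proof (rule inc_induct[of 0 M P])
    have "{j. j < v \<and> M \<le> h j} = {}" using M by fastforce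
    then show "P M" unfolding P_def by (intro allI impI exI[of _ "\<lambda>_. 0"]) (simp only:, simp)
  next
    fix e assume IH: "P (Suc e)"
    obtain z :: "nat \<Rightarrow> rat" where z: "\<forall>j<v. h j = e \<longrightarrow> z j = 1" "\<forall>j<v. e < h j \<longrightarrow> z j = 0"
      "\<forall>i<u. (\<Sum>j<v. A i j * z j) = 0" using h by blast
    define I where "I = {j. j < v \<and> h j = e}"
    define J where "J = {j. j < v \<and> Suc e \<le> h j}"
    have IJ: "{j. j < v \<and> e \<le> h j} = I \<union> J" by (auto simp: I_def J_def)
    show "P e"
    \<comment> \<open>A rank that no column has is skipped, since
      \<open>kernel_solution_step\<close> takes a nonempty group.\<close>
    proof (cases "I = {}")
      case True
      then show ?thesis using IH unfolding P_def IJ by (simp add: J_def)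
    next
      case False
      show ?thesis unfolding P_def IJ
        by (intro allI impI kernel_solution_step[OF p, where z = z])
          (use IH z False in \<open>auto simp: P_def I_def J_def\<close>)
    qed
  qed simp
  then obtain x :: "nat \<Rightarrow> int" where x: "\<forall>i<u. (\<Sum>j<v. A i j * of_int (x j)) = 0"
    "\<forall>j\<in>{j. j < v \<and> 0 \<le> h j}. x j \<in> int ` C"
    unfolding P_def using C zero_less_one by meson
  have "\<forall>j<v. x j \<in> int ` C" using x(2) by simp
  then have *: "\<forall>j<v. nat (x j) \<in> C \<and> x j = int (nat (x j))" by auto
  have "(\<Sum>j<v. A i j * of_nat (nat (x j))) = (\<Sum>j<v. A i j * of_int (x j))" for i
    using * by (intro sum.cong) (metis, metis lessThan_iff of_int_of_nat_eq)
  then show ?thesis using x(1) * by (intro exI[of _ "\<lambda>j. nat (x j)"]) simp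
qed

theorem theorem2p2:
  fixes p :: "nat set set"
    and B :: "nat \<Rightarrow> nat set"
    and u m :: "nat \<Rightarrow> nat"
    and A :: "nat \<Rightarrow> nat \<Rightarrow> nat \<Rightarrow> rat"
  assumes "minimal_idempotent p"
    and "\<forall>n\<in>Npos. B n \<in> p"
    and "\<forall>n\<in>Npos. kernel_PR (u n) (m n) (A n)"
  shows "\<exists>x :: nat \<Rightarrow> nat \<Rightarrow> nat.
           (\<forall>n\<in>Npos. (\<forall>j<m n. x n j \<in> Npos) \<and>
                      (\<forall>i<u n. (\<Sum>j<m n. A n i j * of_nat (x n j)) = 0)) \<and>
           (\<forall>F. finite F \<and> F \<noteq> {} \<and> F \<subseteq> Npos \<longrightarrow>
                 setsum_family F (\<lambda>n. x n ` {..<m n}) \<subseteq> B (Min F))"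
proof -
  have pb: "p \<in> betaN" and idem: "bplus p p = p" using assms(1) by (auto simp: minimal_idempotent_def)
  have up: "is_ultrafilter p" using pb by (simp add: betaN_def)
  \<comment> \<open>\<open>idempotent_sequence\<close> runs over all naturals, so the index 0 gets
    the dummy values \<open>{}\<close> for \<open>E\<close> and \<open>Npos\<close> for
    \<open>B'\<close>.\<close>
  define E where "E n x = (if n \<in> Npos then x ` {..<m n} else {})" for n and x :: "nat \<Rightarrow> nat"
  define Q where "Q n x \<longleftrightarrow> (n \<in> Npos \<longrightarrow> (\<forall>j<m n. x j \<in> Npos) \<and>
      (\<forall>i<u n. (\<Sum>j<m n. A n i j * of_nat (x j)) = 0))" for n and x :: "nat \<Rightarrow> nat"
  define B' where "B' n = (if n \<in> Npos then B n else Npos)" for n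
  have "\<exists>x. (\<forall>n. Q n (x n)) \<and>
    (\<forall>F a. finite F \<and> F \<noteq> {} \<and> (\<forall>n\<in>F. a n \<in> E n (x n)) \<longrightarrow> sum a F \<in> B' (Min F))"
  proof (rule idempotent_sequence[OF pb idem])
    show "B' n \<in> p" for n using assms(2) ultrafilter_Npos[OF up] by (simp add: B'_def)
    show "finite (E n x)" for n x by (simp add: E_def)
    fix n D assume D: "D \<in> p"
    show "\<exists>x. Q n x \<and> E n x \<subseteq> D"
    proof (cases "n \<in> Npos")
      case True
      then obtain x where "\<forall>j<m n. x j \<in> D" "\<forall>i<u n. (\<Sum>j<m n. A n i j * of_nat (x j)) = 0"
        using kernel_PR_minimal_idempotent[OF assms(1) _ D] assms(3) by blast
      then show ?thesis using ultrafilter_subset[OF up D] by (intro exI[of _ x]) (auto simp: Q_def E_def)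
    qed (simp add: Q_def E_def)
  qed
  then obtain x where "\<forall>n. Q n (x n)" and
    x2: "\<forall>F a. finite F \<and> F \<noteq> {} \<and> (\<forall>n\<in>F. a n \<in> E n (x n)) \<longrightarrow> sum a F \<in> B' (Min F)"
    by (elim exE conjE)
  have "setsum_family F (\<lambda>n. x n ` {..<m n}) \<subseteq> B (Min F)" if F: "finite F" "F \<noteq> {}" "F \<subseteq> Npos" for F
  proof
    fix s assume "s \<in> setsum_family F (\<lambda>n. x n ` {..<m n})"
    then obtain a where a: "s = sum a F" "\<forall>n\<in>F. a n \<in> x n ` {..<m n}" by (auto simp: setsum_family_def)
    then have "\<forall>n\<in>F. a n \<in> E n (x n)" using F by (auto simp: E_def)
    then have "s \<in> B' (Min F)" using x2[rule_format, of F a] F a by simp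
    moreover have "Min F \<in> Npos" using Min_in F by blast
    ultimately show "s \<in> B (Min F)" by (simp add: B'_def)
  qed
  then show ?thesis using \<open>\<forall>n. Q n (x n)\<close> by (intro exI[of _ x]) (simp add: Q_def)
qed

end
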